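(* Let ${\bf n}=n_0n_1n_2\cdots$ be the fixed point starting with $0$ of the morphism $\nu:0\mapsto01,\ 1\mapsto2,\ 2\mapsto0$ (so ${\bf n}=0120010120120\cdots$). Then the critical exponent of ${\bf n}$ equals $(\alpha^2+\alpha+5)/3\approx 2.8711567558605$, where $\alpha$ is the real root of $X^3=X^2+1$.
   Context: A finite word $w=w[0..n]$ has period $p$ ($1\le p\le n+1$) if $w[0..n-p]=w[p..n]$; the smallest period is $\mathrm{per}(w)$, and the exponent of $w$ is $|w|/\mathrm{per}(w)$. The critical exponent of an infinite word is the supremum of the exponents of its nonempty finite factors. *)

theory Defs
  imports "HOL-Analysis.Analysis"
begin

text \<open>Finite words are lists, infinite words are functions on the natural numbers.\<close>

definition has_period :: "'a list \<Rightarrow> nat \<Rightarrow> bool" where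
  "has_period w p \<longleftrightarrow> 1 \<le> p \<and> p \<le> length w \<and> take (length w - p) w = drop p w"

definition per :: "'a list \<Rightarrow> nat" where
  "per w = (LEAST p. has_period w p)"

definition exponent :: "'a list \<Rightarrow> real" where
  "exponent w = real (length w) / real (per w)"

definition factors :: "(nat \<Rightarrow> 'a) \<Rightarrow> 'a list set" where
  "factors x = {map x [i..<j] | i j. i \<le> j}"

text \<open>The supremum is taken in the extended reals, so that it is meaningful for
  words of unbounded exponent, too.\<close>

definition critical_exponent :: "(nat \<Rightarrow> 'a) \<Rightarrow> ereal" where
  "critical_exponent x = (SUP w \<in> factors x - {[]}. ereal (exponent w))"

definition morph :: "('a \<Rightarrow> 'b list) \<Rightarrow> 'a list \<Rightarrow> 'b list" where
  "morph h w = concat (map h w)"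

text \<open>The image of an infinite word under a non-erasing morphism: all letters have nonempty
  images, so the images of the first \<open>i + 1\<close> letters already determine position \<open>i\<close>.\<close>

definition morph_inf :: "('a \<Rightarrow> 'b list) \<Rightarrow> (nat \<Rightarrow> 'a) \<Rightarrow> nat \<Rightarrow> 'b" where
  "morph_inf h x i = morph h (map x [0..<Suc i]) ! i"

datatype letter = L0 | L1 | L2

fun nu :: "letter \<Rightarrow> letter list" where
  "nu L0 = [L0, L1]"
| "nu L1 = [L2]"
| "nu L2 = [L0]"

definition fixed_point_from :: "('a \<Rightarrow> 'a list) \<Rightarrow> 'a \<Rightarrow> (nat \<Rightarrow> 'a) \<Rightarrow> bool" where
  "fixed_point_from h a x \<longleftrightarrow> morph_inf h x = x \<and> x 0 = a"

lemma morph_append: "morph h (u @ v) = morph h u @ morph h v"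
  by (simp add: morph_def)

lemma nu_length_pos: "1 \<le> length (nu a)"
  by (cases a) auto

lemma length_morph_nu: "length w \<le> length (morph nu w)"
proof (induction w)
  case (Cons a w)
  then show ?case using nu_length_pos[of a] by (simp add: morph_def)
qed (simp add: morph_def)

lemma fixed_point_nu_rec:
  assumes "fixed_point_from nu L0 x" "i > 0"
  shows "x i = morph nu (map x [0..<i]) ! i"
proof -
  obtain j where i: "i = Suc j" using assms(2) by (cases i) auto
  have x0: "x 0 = L0" and fp: "morph_inf nu x i = x i"
    using assms(1) by (auto simp: fixed_point_from_def)
  have split: "map x [0..<i] = L0 # map x [1..<i]"
    using x0 by (simp add: i upt_conv_Cons del: upt_Suc)
  have "i < length (morph nu (map x [0..<i]))"
    using length_morph_nu[of "map x [1..<i]"] assms(2)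
    unfolding split by (simp add: morph_def)
  then show ?thesis
    using fp by (simp add: morph_inf_def morph_append nth_append)
qed

lemma fixed_point_nu_unique:
  assumes "fixed_point_from nu L0 x" "fixed_point_from nu L0 y"
  shows "x = y"
proof
  fix i show "x i = y i"
  proof (induction i rule: less_induct)
    case (less i)
    show ?case
    proof (cases "i = 0")
      case True
      then show ?thesis using assms by (simp add: fixed_point_from_def)
    next
      case False
      have "map x [0..<i] = map y [0..<i]" using less by simp
      then show ?thesis
        using False fixed_point_nu_rec[OF assms(1), of i] fixed_point_nu_rec[OF assms(2), of i]
        by (metis neq0_conv)
    qed
  qed
qed

lemma fixed_point_nu_exists: "\<exists>x. fixed_point_from nu L0 x"
proof -
  define P where "P k = (morph nu ^^ k) [L0]" for k
  have PS: "P (Suc k) = morph nu (P k)" for k by (simp add: P_def)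
  have P0: "P 0 = [L0]" by (simp add: P_def)
  have step: "\<exists>q. q \<noteq> [] \<and> P (Suc k) = P k @ q" for k
  proof (induction k)
    case 0
    show ?case by (simp add: PS P0 morph_def)
  next
    case (Suc k)
    then obtain q where q: "q \<noteq> []" "P (Suc k) = P k @ q" by blast
    have "P (Suc (Suc k)) = P (Suc k) @ morph nu q"
      using q(2) by (metis PS morph_append)
    moreover have "morph nu q \<noteq> []"
      using q(1) length_morph_nu[of q] by (cases q) auto
    ultimately show ?case by blast
  qed
  have len: "k < length (P k)" for k
  proof (induction k)
    case (Suc k)
    obtain q where q: "q \<noteq> []" "P (Suc k) = P k @ q" using step by blast
    have "length q \<ge> 1" using q(1) by (cases q) auto
    then show ?case using Suc by (simp add: q(2))
  qed (simp add: P0)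
  have stable: "P (i + d) ! i = P i ! i" for i d
  proof (induction d)
    case (Suc d)
    obtain q where q: "P (Suc (i + d)) = P (i + d) @ q" using step by blast
    have "i < length (P (i + d))" using len[of "i + d"] by simp
    then show ?case using q Suc by (simp add: nth_append)
  qed simp
  define x where "x i = P i ! i" for i
  have pre: "map x [0..<Suc i] = take (Suc i) (P i)" for i
  proof (rule nth_equalityI)
    show "length (map x [0..<Suc i]) = length (take (Suc i) (P i))"
      using len[of i] by simp
    fix j assume "j < length (map x [0..<Suc i])"
    then have j: "j < Suc i" by simp
    have "P i ! j = P j ! j" using stable[of j "i - j"] j by simp
    moreover have "map x [0..<Suc i] ! j = x j"
      using nth_map_upt[of j "Suc i" 0 x] j by (simp del: upt_Suc)
    ultimately show "map x [0..<Suc i] ! j = take (Suc i) (P i) ! j"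
      using j by (simp add: x_def del: upt_Suc)
  qed
  have "morph_inf nu x i = x i" for i
  proof -
    let ?u = "take (Suc i) (P i)"
    have "P (Suc i) = morph nu ?u @ morph nu (drop (Suc i) (P i))"
      unfolding PS by (metis append_take_drop_id morph_append)
    moreover have "i < length (morph nu ?u)"
      using length_morph_nu[of ?u] len[of i] by simp
    ultimately have "morph nu ?u ! i = P (Suc i) ! i" by (simp add: nth_append)
    then show ?thesis
      using stable[of i 1] unfolding morph_inf_def pre by (simp add: x_def)
  qed
  then have "fixed_point_from nu L0 x"
    by (auto simp: fixed_point_from_def x_def P0)
  then show ?thesis by blast
qed

end

theory Submission
  imports Defs
begin

text \<open>
  A repetition with period \<open>p\<close> is a pair of positions \<open>i\<close>, \<open>j = i + p\<close> whose suffixes agree for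
  some length \<open>m\<close>. The letters \<open>0\<close> and \<open>2\<close> only occur as first letters of blocks
  \<open>\<nu>(a)\<close>, and every \<open>1\<close> is preceded by a \<open>0\<close>, so each pair with \<open>m > 0\<close> is, up to a
  shift by one, the image of a pair with smaller \<open>j\<close>; descending, one reaches a pair that
  disagrees at once. Going back up, the agreement \<open>w\<close> turns into \<open>\<nu>(w)\<close>, followed by one extra \<open>0\<close>
  exactly when the mismatched letters are \<open>0\<close> and \<open>2\<close>, which happens in every second step. With
  \<open>N\<^sub>k = |\<nu>\<^sup>k(0)|\<close> this gives \<open>m \<le> N\<^sub>k + N\<^sub>k\<^sub>-\<^sub>2 + \<dots>\<close> and \<open>p \<ge> N\<^sub>k\<close> for some \<open>k\<close>, and equality is
  attained by starting from the factor \<open>20\<close>. The ratio of the two quantities tends from below to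
  \<open>1 + \<alpha>\<^sup>-\<^sup>2 + \<alpha>\<^sup>-\<^sup>4 + \<dots> = (\<alpha>\<^sup>2 + \<alpha> + 2) / 3\<close>.
\<close>

section \<open>Lengths of the iterated images of letters\<close>

primrec image_length :: "nat \<Rightarrow> letter \<Rightarrow> nat" where
  "image_length 0 a = 1"
| "image_length (Suc r) a = sum_list (map (image_length r) (nu a))"

text \<open>Narayana's cows sequence, from 1, 2, 3, 4, 6, 9 on.\<close>

abbreviation N :: "nat \<Rightarrow> nat" where
  "N r \<equiv> image_length r L0"

text \<open>Applying \<open>nu\<close> twice to \<open>L1\<close> gives \<open>L0\<close>. For
  \<open>r < 2\<close> truncated subtraction yields \<open>N 0 = 1\<close>, still the right
  length.\<close>

lemma image_length_L1: "image_length r L1 = N (r - 2)"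
proof (cases r)
  case (Suc s)
  then show ?thesis by (cases s) auto
qed simp

lemma image_length_L2: "image_length r L2 = N (r - 1)"
  by (cases r) auto

lemma image_length_pos: "1 \<le> image_length r a"
proof (induction r arbitrary: a)
  case (Suc r)
  show ?case using Suc[of L0] Suc[of L2] by (cases a) auto
qed simp

lemma N_Suc: "N (Suc r) = N r + N (r - 2)"
  by (simp add: image_length_L1)

lemma N_mono: "r \<le> s \<Longrightarrow> N r \<le> N s"
  by (rule lift_Suc_mono_le[of N]) (simp_all add: N_Suc)

lemma N_gt: "r < N r"
proof (induction r)
  case (Suc r)
  then show ?case using image_length_pos[of r L1] by simp
qed simp

lemma N_Suc3: "N (r + 3) = N (r + 2) + N r"
  using N_Suc[of "r + 2"] by (simp add: numeral_3_eq_3)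

section \<open>Estimates for \<alpha> and for the growth of \<open>N\<close>\<close>

lemma root_bounds:
  fixes \<alpha> :: real
  assumes "\<alpha> ^ 3 = \<alpha> ^ 2 + 1"
  shows "1.46557123187676 < \<alpha>" "\<alpha> < 1.46557123187678"
proof -
  \<comment> \<open>For x > 1 the function x^2 (x - 1) increases, so comparing its value at a
    decimal with 1 locates \<alpha>.\<close>
  have eq: "\<alpha>\<^sup>2 * (\<alpha> - 1) = 1"
    using assms by (simp add: algebra_simps power2_eq_square power3_eq_cube)
  have pos: "\<alpha> > 1"
    using eq by (smt (verit) mult_nonneg_nonpos zero_le_power2)
  show "1.46557123187676 < \<alpha>"
  proof (rule ccontr)
    assume "\<not> ?thesis"
    then have le: "\<alpha> \<le> 1.46557123187676" by simp
    have "\<alpha>\<^sup>2 * (\<alpha> - 1) \<le> 1.46557123187676\<^sup>2 * (1.46557123187676 - 1)"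
      using le pos by (intro mult_mono power_mono) auto
    then show False using eq by (simp add: power2_eq_square)
  qed
  show "\<alpha> < 1.46557123187678"
  proof (rule ccontr)
    assume "\<not> ?thesis"
    then have le: "1.46557123187678 \<le> \<alpha>" by simp
    have "1.46557123187678\<^sup>2 * (1.46557123187678 - 1) \<le> \<alpha>\<^sup>2 * (\<alpha> - 1)"
      using le pos by (intro mult_mono power_mono) auto
    then show False using eq by (simp add: power2_eq_square)
  qed
qed

lemma root_value:
  fixes \<alpha> :: real
  assumes "\<alpha> ^ 3 = \<alpha> ^ 2 + 1"
  shows "\<bar>(\<alpha> ^ 2 + \<alpha> + 5) / 3 - 2.8711567558605\<bar> < 1 / 10 ^ 13"
proof -
  note b = root_bounds[OF assms]
  have "1.46557123187676\<^sup>2 < \<alpha>\<^sup>2" "\<alpha>\<^sup>2 < 1.46557123187678\<^sup>2"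
    using b by (auto intro!: power_strict_mono)
  then show ?thesis using b by (simp add: power2_eq_square abs_less_iff)
qed

text \<open>The quadratic form below is the norm form of the complex conjugates of \<open>\<alpha>\<close>, whose product
  is \<open>1 / \<alpha> = \<alpha>\<^sup>2 - \<alpha>\<close>; this is the factor by which it shrinks in each step.\<close>

lemma N_ratio_error:
  fixes \<alpha> :: real
  assumes "\<alpha> ^ 3 = \<alpha> ^ 2 + 1"
  shows "\<bar>N (Suc k) - \<alpha> * N k\<bar> \<le> 1"
proof -
  define d where "d k = real (N (Suc k)) - \<alpha> * N k" for k
  define Q where "Q k = (d (Suc k))\<^sup>2 + (\<alpha> - 1) * d (Suc k) * d k + (\<alpha>\<^sup>2 - \<alpha>) * (d k)\<^sup>2" for k
  note b = root_bounds[OF assms]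
  have a2: "2.147 < \<alpha>\<^sup>2" "\<alpha>\<^sup>2 < 2.148"
  proof -
    have "1.46557123187676\<^sup>2 < \<alpha>\<^sup>2" "\<alpha>\<^sup>2 < 1.46557123187678\<^sup>2"
      using b by (auto intro!: power_strict_mono)
    then show "2.147 < \<alpha>\<^sup>2" "\<alpha>\<^sup>2 < 2.148" by (simp_all add: power2_eq_square)
  qed
  have lower: "(d k)\<^sup>2 / 2 \<le> Q k" for k
  proof -
    have sq: "(\<alpha> - 1)\<^sup>2 = \<alpha>\<^sup>2 - 2 * \<alpha> + 1" by (simp add: power2_eq_square algebra_simps)
    have "0 \<le> \<alpha>\<^sup>2 - \<alpha> - (\<alpha> - 1)\<^sup>2 / 4 - 1 / 2" unfolding sq using a2 b by (simp add: field_simps)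
    then have "0 \<le> (d (Suc k) + (\<alpha> - 1) / 2 * d k)\<^sup>2
      + (\<alpha>\<^sup>2 - \<alpha> - (\<alpha> - 1)\<^sup>2 / 4 - 1 / 2) * (d k)\<^sup>2" by simp
    also have "\<dots> = Q k - (d k)\<^sup>2 / 2"
      unfolding Q_def by (simp add: power2_eq_square field_simps)
    finally show ?thesis by simp
  qed
  \<comment> \<open>X^3 - X^2 - 1 = (X - \<alpha>) (X^2 + (\<alpha> - 1) X + \<alpha>^2 - \<alpha>);
    passing from \<open>N\<close> to \<open>d\<close> strips off the first factor.\<close>
  have rec: "d (k + 2) = - (\<alpha> - 1) * d (Suc k) - (\<alpha>\<^sup>2 - \<alpha>) * d k" for k
  proof -
    have "real (N (k + 3)) = N (k + 2) + N k" using N_Suc3[of k] by simp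
    moreover have "\<alpha> * (\<alpha> * \<alpha>) = \<alpha> * \<alpha> + 1"
      using assms by (simp add: power2_eq_square power3_eq_cube)
    ultimately show ?thesis
      unfolding d_def power2_eq_square by (simp add: numeral_3_eq_3 del: image_length.simps) algebra
  qed
  have step: "Q (Suc k) = (\<alpha>\<^sup>2 - \<alpha>) * Q k" for k
  proof -
    have "d (Suc (Suc k)) = - (\<alpha> - 1) * d (Suc k) - (\<alpha>\<^sup>2 - \<alpha>) * d k"
      using rec[of k] by simp
    then show ?thesis unfolding Q_def power2_eq_square by algebra
  qed
  \<comment> \<open>By \<open>lower\<close>, the bound 1/2 is what makes the square of
    \<open>d k\<close> at most 1.\<close>
  have "Q k \<le> 1 / 2"
  proof (induction k)
    case 0
    have d: "d 0 = 2 - \<alpha>" "d (Suc 0) = 3 - 2 * \<alpha>" by (simp_all add: d_def)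
    have "Q 0 = (3 - 2 * \<alpha>)\<^sup>2 + (\<alpha> - 1) * (3 - 2 * \<alpha>) * (2 - \<alpha>) + (\<alpha>\<^sup>2 - \<alpha>) * (2 - \<alpha>)\<^sup>2"
      unfolding Q_def d ..
    also have "\<dots> \<le> 0.1\<^sup>2 + 0.5 * 0.1 * 0.6 + 0.71 * 0.6\<^sup>2"
      using b a2 by (intro add_mono mult_mono power_mono) auto
    also have "\<dots> \<le> 1 / 2" by (simp add: power2_eq_square)
    finally show ?case .
  next
    case (Suc k)
    have "0 \<le> Q k" using lower[of k] by (meson order_trans zero_le_power2 divide_nonneg_pos zero_less_numeral)
    then have "(\<alpha>\<^sup>2 - \<alpha>) * Q k \<le> 1 * Q k" using a2 b by (intro mult_right_mono) auto
    then show ?case using Suc step[of k] by simp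
  qed
  then have "(d k)\<^sup>2 \<le> 1\<^sup>2" using lower[of k] by simp
  then show ?thesis unfolding d_def using abs_le_square_iff[of _ "1::real"] by auto
qed

text \<open>A telescoping sum: f(k) = N(k+2) + N(k+1) + 2 N(k) satisfies f(k+2) - f(k) = 3
  N(k+2).\<close>

lemma three_sum_N:
  "3 * (\<Sum>s<Suc t. real (N (r + 2 * s)))
    = N (r + 2 * t + 2) + N (r + 2 * t + 1) + 2 * N (r + 2 * t)
      - (real (N (r + 2)) + N (r + 1) - N r)"
proof (induction t)
  case (Suc t)
  then show ?case
    using N_Suc3[of "r + 2 * t"] N_Suc3[of "r + 2 * t + 1"]
    by (simp add: numeral_3_eq_3 algebra_simps del: image_length.simps)
qed simp

text \<open>In \<open>three_sum_N\<close>, replacing N(k+2) + N(k+1) by (\<alpha>^2 + \<alpha>) N(k)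
  costs at most 4. The subtracted initial term is at least 4, which absorbs this in the upper bound;
  for \<open>r = 1\<close> it is 5, so the lower bound loses at most (4 + 5) / 3 = 3.\<close>

lemma sum_N_bounds:
  fixes \<alpha> :: real
  assumes "\<alpha> ^ 3 = \<alpha> ^ 2 + 1"
  shows "(\<Sum>s<Suc t. real (N (r + 2 * s))) \<le> (\<alpha>\<^sup>2 + \<alpha> + 2) / 3 * N (r + 2 * t)"
    and "(\<alpha>\<^sup>2 + \<alpha> + 2) / 3 * N (1 + 2 * t) - 3 \<le> (\<Sum>s<Suc t. real (N (1 + 2 * s)))"
proof -
  note b = root_bounds[OF assms]
  have err: "\<bar>N (k + 2) + N (k + 1) - (\<alpha>\<^sup>2 + \<alpha>) * N k\<bar> \<le> 4" for k
  proof -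
    let ?d = "\<lambda>k. real (N (k + 1)) - \<alpha> * N k"
    have "N (k + 2) + N (k + 1) - (\<alpha>\<^sup>2 + \<alpha>) * N k = ?d (k + 1) + (\<alpha> + 1) * ?d k"
      by (simp add: power2_eq_square algebra_simps del: image_length.simps)
    also have "\<bar>?d (k + 1) + (\<alpha> + 1) * ?d k\<bar> \<le> 1 + (\<alpha> + 1) * 1"
    proof (rule order_trans[OF abs_triangle_ineq add_mono])
      show "\<bar>?d (k + 1)\<bar> \<le> 1" using N_ratio_error[OF assms, of "k + 1"] by simp
      show "\<bar>(\<alpha> + 1) * ?d k\<bar> \<le> (\<alpha> + 1) * 1"
        unfolding abs_mult using N_ratio_error[OF assms, of k] b by (intro mult_mono) auto
    qed
    also have "\<dots> \<le> 4" using b by simp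
    finally show ?thesis .
  qed
  \<comment> \<open>The right-hand side equals
    \<open>N r + 2 * image_length r L1 + image_length r L2\<close>.\<close>
  have "4 \<le> real (N (r + 2)) + N (r + 1) - N r"
    using image_length_pos[of r L0] image_length_pos[of r L1] image_length_pos[of r L2]
    by (simp add: numeral_2_eq_2)
  then show "(\<Sum>s<Suc t. real (N (r + 2 * s))) \<le> (\<alpha>\<^sup>2 + \<alpha> + 2) / 3 * N (r + 2 * t)"
    using three_sum_N[of r t] err[of "r + 2 * t"] by (simp add: field_simps)
  have "real (N (1 + 2)) + N (1 + 1) - N 1 = 5"
    by (simp add: numeral_3_eq_3 numeral_2_eq_2)
  then show "(\<alpha>\<^sup>2 + \<alpha> + 2) / 3 * N (1 + 2 * t) - 3 \<le> (\<Sum>s<Suc t. real (N (1 + 2 * s)))"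
    using three_sum_N[of 1 t] err[of "1 + 2 * t"] by (simp add: field_simps)
qed

section \<open>Block structure of the fixed point\<close>

locale nu_fixed_point =
  fixes n :: "nat \<Rightarrow> letter"
  assumes fixed_point: "fixed_point_from nu L0 n"
begin

text \<open>The position in \<open>n\<close> at which the block \<open>nu (n i)\<close> starts, see
  \<open>n_block\<close>.\<close>

definition pos :: "nat \<Rightarrow> nat" where
  "pos i = length (morph nu (map n [0..<i]))"

lemma pos_0 [simp]: "pos 0 = 0"
  by (simp add: pos_def morph_def)

lemma pos_Suc: "pos (Suc i) = pos i + length (nu (n i))"
  by (simp add: pos_def morph_def)

lemma n_0: "n 0 = L0"
  using fixed_point by (simp add: fixed_point_from_def)

text \<open>\<open>morph_inf\<close> reads position \<open>x\<close> off the image of the first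
  \<open>x + 1\<close> letters; of two prefix images one extends the other, so they agree wherever
  both are defined.\<close>

lemma n_prefix_morph:
  assumes "x < pos k"
  shows "n x = morph nu (map n [0..<k]) ! x"
proof -
  have ext: "morph nu (map n [0..<b]) ! x = morph nu (map n [0..<a]) ! x"
    if "a \<le> b" "x < pos a" for a b
  proof -
    have "[0..<b] = [0..<a] @ [a..<b]" using that(1) upt_add_eq_append[of 0 a "b - a"] by simp
    then show ?thesis using that(2) by (simp add: morph_append nth_append pos_def)
  qed
  have "x < pos (Suc x)"
    using length_morph_nu[of "map n [0..<Suc x]"] by (simp add: pos_def)
  then have "morph nu (map n [0..<Suc x]) ! x = morph nu (map n [0..<k]) ! x"
    using ext[of "Suc x" k] ext[of k "Suc x"] assms by (cases "k \<le> Suc x") auto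
  then show ?thesis
    using fixed_point unfolding fixed_point_from_def morph_inf_def by metis
qed

lemma n_block:
  assumes "d < length (nu (n i))"
  shows "n (pos i + d) = nu (n i) ! d"
  using n_prefix_morph[of "pos i + d" "Suc i"] assms
  by (simp add: pos_Suc morph_append nth_append) (simp add: morph_def pos_def nth_append)

lemma n_pos: "n (pos i) = hd (nu (n i))"
  using n_block[of 0 i] by (cases "n i") auto

lemma n_Suc_pos: "n i = L0 \<Longrightarrow> n (Suc (pos i)) = L1"
  using n_block[of 1 i] by simp

lemma n_pos_neq_L1: "n (pos i) \<noteq> L1"
  by (cases "n i") (simp_all add: n_pos)

lemma strict_mono_pos: "strict_mono pos"
  using nu_length_pos by (intro strict_mono_Suc_iff[THEN iffD2]) (auto simp: pos_Suc Suc_le_eq)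

text \<open>The first block already has two letters. The strictness makes the descent to block
  indices terminate.\<close>

lemma pos_gt: "0 < i \<Longrightarrow> i < pos i"
proof (induction i)
  case (Suc i)
  then show ?case using nu_length_pos[of "n i"] by (cases "i = 0") (auto simp: pos_Suc n_0)
qed simp

lemma pos_cases: "\<exists>i. x = pos i \<or> (x = Suc (pos i) \<and> n i = L0)"
proof (induction x)
  case 0
  show ?case by (metis pos_0)
next
  case (Suc x)
  then obtain i where "x = pos i \<or> (x = Suc (pos i) \<and> n i = L0)" by blast
  then show ?case
  proof
    assume "x = pos i"
    then show ?thesis using pos_Suc[of i] by (cases "n i") (auto intro: exI[of _ i] exI[of _ "Suc i"])
  next
    assume "x = Suc (pos i) \<and> n i = L0"
    then show ?thesis using pos_Suc[of i] by (auto intro: exI[of _ "Suc i"])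
  qed
qed

lemma L1_preceded_by_L0:
  assumes "n x = L1"
  obtains y where "x = Suc y" "n y = L0"
  using pos_cases[of x] assms n_pos_neq_L1 n_pos by (metis list.sel(1) nu.simps(1))

lemma not_L1_pos: "n x \<noteq> L1 \<Longrightarrow> \<exists>i. x = pos i"
  using pos_cases[of x] n_Suc_pos by auto

text \<open>\<open>weight r i j\<close> is the length of the \<open>r\<close>-fold image of the factor of \<open>n\<close> on \<open>{i..<j}\<close>.\<close>

definition weight :: "nat \<Rightarrow> nat \<Rightarrow> nat \<Rightarrow> nat" where
  "weight r i j = (\<Sum>x\<in>{i..<j}. image_length r (n x))"

lemma weight_0 [simp]: "weight 0 i j = j - i"
  by (simp add: weight_def)

lemma weight_empty [simp]: "weight r i i = 0"
  by (simp add: weight_def)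

lemma weight_Suc_right: "i \<le> j \<Longrightarrow> weight r i (Suc j) = weight r i j + image_length r (n j)"
  by (simp add: weight_def)

lemma weight_Suc_left: "i < j \<Longrightarrow> weight r i j = image_length r (n i) + weight r (Suc i) j"
  by (simp add: weight_def sum.atLeast_Suc_lessThan)

lemma image_length_le_weight: "i \<le> x \<Longrightarrow> x < j \<Longrightarrow> image_length r (n x) \<le> weight r i j"
  unfolding weight_def by (rule member_le_sum) auto

text \<open>The \<open>r\<close>-fold image of \<open>nu a\<close> is the \<open>Suc r\<close>-fold
  image of \<open>a\<close>.\<close>

lemma weight_pos: "i \<le> j \<Longrightarrow> weight r (pos i) (pos j) = weight (Suc r) i j"
proof (induction j rule: dec_induct)
  case (step j)
  have le: "pos i \<le> pos j" using step(1) strict_mono_pos by (simp add: strict_mono_less_eq)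
  show ?case
    using step le n_pos[of j] n_Suc_pos[of j]
    by (cases "n j") (simp_all add: weight_Suc_right pos_Suc)
qed simp

section \<open>Agreements and mismatches under \<open>nu\<close>\<close>

definition agree :: "nat \<Rightarrow> nat \<Rightarrow> nat \<Rightarrow> bool" where
  "agree i j m \<longleftrightarrow> (\<forall>d<m. n (i + d) = n (j + d))"

lemma agree_Suc: "agree i j (Suc m) \<longleftrightarrow> agree i j m \<and> n (i + m) = n (j + m)"
  by (auto simp: agree_def less_Suc_eq)

lemma agree_pos:
  assumes "agree i j m"
  shows "\<exists>m'. pos (i + m) = pos i + m' \<and> pos (j + m) = pos j + m' \<and> agree (pos i) (pos j) m'"
  using assms
proof (induction m)
  case 0
  show ?case by (simp add: agree_def)
next
  case (Suc m)
  then have eq: "n (i + m) = n (j + m)" and "agree i j m" by (simp_all add: agree_Suc)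
  with Suc.IH obtain m' where m': "pos (i + m) = pos i + m'" "pos (j + m) = pos j + m'"
    "agree (pos i) (pos j) m'" by blast
  let ?l = "length (nu (n (i + m)))"
  have "n (pos i + (m' + d)) = n (pos j + (m' + d))" if "d < ?l" for d
    using n_block[of d "i + m"] n_block[of d "j + m"] that eq m' by (simp add: add.assoc)
  then have "agree (pos i) (pos j) (m' + ?l)"
    using m'(3) unfolding agree_def by (metis add_diff_inverse_nat nat_add_left_cancel_less)
  then show ?case using m' eq by (auto simp: pos_Suc)
qed

text \<open>The letters at a mismatch determine how the agreement extends under \<open>\<nu>\<close>: images of \<open>L0\<close> and
  \<open>L2\<close> share one letter, whereas the image of \<open>L1\<close> shares no prefix with the others.\<close>

definition mismatch_one :: "nat \<Rightarrow> nat \<Rightarrow> nat \<Rightarrow> bool" where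
  "mismatch_one i j m \<longleftrightarrow> agree i j m \<and> (n (i + m) = L1) \<noteq> (n (j + m) = L1)"

definition mismatch_zero_two :: "nat \<Rightarrow> nat \<Rightarrow> nat \<Rightarrow> bool" where
  "mismatch_zero_two i j m \<longleftrightarrow>
    agree i j m \<and> n (i + m) \<noteq> n (j + m) \<and> n (i + m) \<noteq> L1 \<and> n (j + m) \<noteq> L1"

lemma mismatch_one_pos:
  assumes "mismatch_one i j m"
  shows "\<exists>m'. mismatch_zero_two (pos i) (pos j) m' \<and>
    (\<forall>r. weight r (pos i) (pos i + m') = weight (Suc r) i (i + m))"
proof -
  obtain m' where m': "pos (i + m) = pos i + m'" "pos (j + m) = pos j + m'"
    "agree (pos i) (pos j) m'"
    using assms agree_pos unfolding mismatch_one_def by blast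
  have "mismatch_zero_two (pos i) (pos j) m'"
    using assms m' n_pos[of "i + m"] n_pos[of "j + m"]
    unfolding mismatch_zero_two_def mismatch_one_def
    by (cases "n (i + m)"; cases "n (j + m)") auto
  then show ?thesis using m'(1) weight_pos[of i "i + m"] by (auto intro!: exI[of _ m'])
qed

text \<open>Both images start with \<open>L0\<close>, which contributes \<open>N r\<close>. After it
  the image of \<open>L0\<close> has \<open>L1\<close>, whereas the image of \<open>L2\<close> has
  ended and the next block cannot start with \<open>L1\<close>.\<close>

lemma mismatch_zero_two_pos:
  assumes "mismatch_zero_two i j m"
  shows "\<exists>m'. mismatch_one (pos i) (pos j) m' \<and>
    (\<forall>r. weight r (pos i) (pos i + m') = weight (Suc r) i (i + m) + N r)"
proof -
  obtain m' where m': "pos (i + m) = pos i + m'" "pos (j + m) = pos j + m'"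
    "agree (pos i) (pos j) m'"
    using assms agree_pos unfolding mismatch_zero_two_def by blast
  have next_neq: "n (Suc (pos x)) \<noteq> L1" if "n x = L2" for x
    using that n_pos_neq_L1[of "Suc x"] by (simp add: pos_Suc)
  have L0: "n (pos i + m') = L0" "n (pos j + m') = L0"
    and one: "(n (Suc (pos i + m')) = L1) \<noteq> (n (Suc (pos j + m')) = L1)"
    using assms m'(1,2) n_pos[of "i + m"] n_pos[of "j + m"] n_Suc_pos[of "i + m"]
      n_Suc_pos[of "j + m"] next_neq[of "i + m"] next_neq[of "j + m"]
    unfolding mismatch_zero_two_def
    by (cases "n (i + m)"; cases "n (j + m)"; auto)+
  have "mismatch_one (pos i) (pos j) (Suc m')"
    using m'(3) L0 one by (simp add: mismatch_one_def agree_Suc)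
  moreover have "weight r (pos i) (pos i + Suc m') = weight (Suc r) i (i + m) + N r" for r
    using m'(1) weight_pos[of i "i + m" r] L0 by (simp add: weight_Suc_right)
  ultimately show ?thesis by blast
qed

text \<open>The invariant of the descent. At \<open>t = 0\<close> the truncated subtractions give exactly the lengths of
  the iterated images of \<open>L1\<close> and \<open>L2\<close>.\<close>

definition bounded_one :: "nat \<Rightarrow> nat \<Rightarrow> nat \<Rightarrow> nat \<Rightarrow> bool" where
  "bounded_one t i j m \<longleftrightarrow> mismatch_one i j m \<and>
    (\<forall>r. weight r i (i + m) \<le> (\<Sum>s<t. N (r + 2 * s)) \<and> N (r + 2 * t - 2) \<le> weight r i j)"

definition bounded_zero_two :: "nat \<Rightarrow> nat \<Rightarrow> nat \<Rightarrow> nat \<Rightarrow> bool" where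
  "bounded_zero_two t i j m \<longleftrightarrow> mismatch_zero_two i j m \<and>
    (\<forall>r. weight r i (i + m) \<le> (\<Sum>s<t. N (r + 1 + 2 * s)) \<and> N (r + 2 * t - 1) \<le> weight r i j)"

text \<open>Each image trades \<open>r\<close> for \<open>Suc r\<close> in the weights, which is why
  the invariant is kept for all \<open>r\<close> at once.\<close>

lemma bounded_one_pos:
  assumes "bounded_one t i j m" "i < j"
  shows "\<exists>m'. bounded_zero_two t (pos i) (pos j) m'"
proof -
  obtain m' where m': "mismatch_zero_two (pos i) (pos j) m'"
    "\<And>r. weight r (pos i) (pos i + m') = weight (Suc r) i (i + m)"
    using assms mismatch_one_pos unfolding bounded_one_def by blast
  have "weight (Suc r) i (i + m) \<le> (\<Sum>s<t. N (r + 1 + 2 * s))"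
    "N (r + 2 * t - 1) \<le> weight (Suc r) i j" for r
  proof -
    have "weight (Suc r) i (i + m) \<le> (\<Sum>s<t. N (Suc r + 2 * s))"
      "N (Suc r + 2 * t - 2) \<le> weight (Suc r) i j"
      using assms(1) unfolding bounded_one_def by blast+
    then show "weight (Suc r) i (i + m) \<le> (\<Sum>s<t. N (r + 1 + 2 * s))"
      "N (r + 2 * t - 1) \<le> weight (Suc r) i j"
      by (simp_all add: numeral_2_eq_2 del: image_length.simps)
  qed
  then show ?thesis
    using m' assms(2) by (auto simp: bounded_zero_two_def weight_pos intro!: exI[of _ m'])
qed

lemma bounded_zero_two_pos:
  assumes "bounded_zero_two t i j m" "i < j"
  shows "\<exists>m'. bounded_one (Suc t) (pos i) (pos j) m'"
proof -
  obtain m' where m': "mismatch_one (pos i) (pos j) m'"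
    "\<And>r. weight r (pos i) (pos i + m') = weight (Suc r) i (i + m) + N r"
    using assms mismatch_zero_two_pos unfolding bounded_zero_two_def by blast
  have "weight (Suc r) i (i + m) + N r \<le> (\<Sum>s<Suc t. N (r + 2 * s))"
    "N (r + 2 * t) \<le> weight (Suc r) i j" for r
  proof -
    have "weight (Suc r) i (i + m) \<le> (\<Sum>s<t. N (Suc r + 1 + 2 * s))"
      "N (Suc r + 2 * t - 1) \<le> weight (Suc r) i j"
      using assms(1) unfolding bounded_zero_two_def by blast+
    then show "weight (Suc r) i (i + m) + N r \<le> (\<Sum>s<Suc t. N (r + 2 * s))"
      "N (r + 2 * t) \<le> weight (Suc r) i j"
      by (simp_all add: sum.lessThan_Suc_shift del: image_length.simps sum.lessThan_Suc)
  qed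
  then show ?thesis
    using m' assms(2) by (auto simp: bounded_one_def weight_pos intro!: exI[of _ m'])
qed

section \<open>Upper bound on agreements by descent\<close>

lemma exists_bounded:
  assumes "i < j"
  shows "\<exists>t m. bounded_one t i j m \<or> bounded_zero_two t i j m"
  using assms
proof (induction j arbitrary: i rule: less_induct)
  case (less j)
  consider (neq) "n i \<noteq> n j" | (L1) "n i = L1" "n j = L1" | (other) "n i = n j" "n i \<noteq> L1"
    by metis
  then show ?case
  proof cases
    case neq
    \<comment> \<open>The shortest \<open>r\<close>-fold image is that of \<open>L1\<close>; once
      \<open>L1\<close> is excluded it is that of \<open>L2\<close>, of length
      \<open>N (r - 1)\<close>.\<close>
    have "N (r - 2) \<le> weight r i j" for r
    proof -
      have "N (r - 2) \<le> image_length r (n i)"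
        by (cases "n i") (auto simp: image_length_L1 image_length_L2 intro!: N_mono)
      then show ?thesis using image_length_le_weight[of i i j r] less.prems by simp
    qed
    moreover have "N (r - 1) \<le> weight r i j" if "n i \<noteq> L1" for r
    proof -
      have "N (r - 1) \<le> image_length r (n i)"
        using that by (cases "n i") (auto simp: image_length_L2 intro!: N_mono)
      then show ?thesis using image_length_le_weight[of i i j r] less.prems by simp
    qed
    ultimately have "bounded_one 0 i j 0 \<or> bounded_zero_two 0 i j 0"
      using neq by (auto simp: bounded_one_def bounded_zero_two_def mismatch_one_def
          mismatch_zero_two_def agree_def)
    then show ?thesis by blast
  next
    case L1
    \<comment> \<open>Both positions are second letters of blocks, so the pair is moved one to the
      left. The letters there agree, hence \<open>m\<close> is positive and dropping one letter
      leaves the mismatch in place.\<close>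
    obtain i' where i': "i = Suc i'" "n i' = L0" using L1(1) by (rule L1_preceded_by_L0)
    obtain j' where j': "j = Suc j'" "n j' = L0" using L1(2) by (rule L1_preceded_by_L0)
    have lt: "i' < j'" using less.prems i' j' by simp
    obtain t m where tm: "bounded_one t i' j' m \<or> bounded_zero_two t i' j' m"
      using less.IH[of j' i'] lt j' by auto
    then have "m \<noteq> 0"
      using i' j' by (auto simp: bounded_one_def bounded_zero_two_def mismatch_one_def
          mismatch_zero_two_def intro!: gr0I)
    then obtain m' where m': "m = Suc m'" by (cases m) auto
    have agree: "agree i j m'" if "agree i' j' m"
      using that unfolding agree_def i' j' m' by (metis Suc_less_eq add_Suc add_Suc_right)
    have w: "weight r i (i + m') \<le> weight r i' (i' + m)" for r
      using weight_Suc_left[of i' "i' + m" r] i' m' by simp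
    \<comment> \<open>The shift exchanges an \<open>L0\<close> at one end for an \<open>L0\<close>
      at the other.\<close>
    have u: "weight r i j = weight r i' j'" for r
      using weight_Suc_left[of i' j' r] weight_Suc_right[of "Suc i'" j' r] i' j' lt by simp
    have shift: "i + m' = i' + m" "j + m' = j' + m" using i' j' m' by simp_all
    show ?thesis
      using tm
    proof
      assume "bounded_one t i' j' m"
      then have "bounded_one t i j m'"
        using agree w unfolding bounded_one_def mismatch_one_def shift u by (meson order_trans)
      then show ?thesis by blast
    next
      assume "bounded_zero_two t i' j' m"
      then have "bounded_zero_two t i j m'"
        using agree w unfolding bounded_zero_two_def mismatch_zero_two_def shift u
        by (meson order_trans)
      then show ?thesis by blast
    qed
  next
    case other
    then obtain i' j' where ij: "i = pos i'" "j = pos j'" using not_L1_pos by metis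
    have lt: "i' < j'" using less.prems strict_mono_pos ij by (simp add: strict_mono_less)
    then have "j' < j" using pos_gt ij by simp
    with less.IH lt obtain t m where "bounded_one t i' j' m \<or> bounded_zero_two t i' j' m" by blast
    then show ?thesis using bounded_one_pos bounded_zero_two_pos lt ij by blast
  qed
qed

lemma agree_le_mismatch:
  assumes "agree i j m" "n (i + m') \<noteq> n (j + m')"
  shows "m \<le> m'"
  using assms unfolding agree_def by (meson not_le)

lemma agree_bound:
  fixes \<alpha> :: real
  assumes \<alpha>: "\<alpha> ^ 3 = \<alpha> ^ 2 + 1" and "i < j" and "agree i j m"
  shows "m \<le> (\<alpha>\<^sup>2 + \<alpha> + 2) / 3 * real (j - i)"
proof -
  obtain t m' where tm: "bounded_one t i j m' \<or> bounded_zero_two t i j m'"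
    using exists_bounded[OF assms(2)] by blast
  have mm: "m \<le> m'"
  proof (rule agree_le_mismatch[OF assms(3)])
    show "n (i + m') \<noteq> n (j + m')"
      using tm by (auto simp: bounded_one_def bounded_zero_two_def mismatch_one_def
          mismatch_zero_two_def)
  qed
  \<comment> \<open>Weights at 0 count letters; \<open>r = 0\<close> and \<open>r = 1\<close> merge
    the two kinds of mismatch into one formula.\<close>
  have "\<exists>r. m' \<le> (\<Sum>s<t. N (r + 2 * s)) \<and> N (r + 2 * t - 2) \<le> j - i"
    using tm
  proof
    assume "bounded_one t i j m'"
    then have "weight 0 i (i + m') \<le> (\<Sum>s<t. N (0 + 2 * s)) \<and> N (0 + 2 * t - 2) \<le> weight 0 i j"
      unfolding bounded_one_def by blast
    then show ?thesis by (intro exI[of _ 0]) simp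
  next
    assume "bounded_zero_two t i j m'"
    then have "weight 0 i (i + m') \<le> (\<Sum>s<t. N (0 + 1 + 2 * s)) \<and> N (0 + 2 * t - 1) \<le> weight 0 i j"
      unfolding bounded_zero_two_def by blast
    then show ?thesis by (intro exI[of _ 1]) (simp add: numeral_2_eq_2 del: image_length.simps)
  qed
  then obtain r where r: "m' \<le> (\<Sum>s<t. N (r + 2 * s))" "N (r + 2 * t - 2) \<le> j - i" by blast
  have c: "0 \<le> (\<alpha>\<^sup>2 + \<alpha> + 2) / 3" using root_bounds[OF \<alpha>] by simp
  show ?thesis
  proof (cases t)
    case 0
    then have "m = 0" using r(1) mm by simp
    then show ?thesis using c by simp
  next
    \<comment> \<open>The last summand, \<open>N (r + 2 * t')\<close>, is exactly the lower bound on
      the period.\<close>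
    case (Suc t')
    have "real m \<le> real (\<Sum>s<t. N (r + 2 * s))" using r(1) mm by linarith
    also have "\<dots> \<le> (\<alpha>\<^sup>2 + \<alpha> + 2) / 3 * N (r + 2 * t')"
      using sum_N_bounds(1)[OF \<alpha>, of r t'] Suc by (simp del: image_length.simps)
    also have "\<dots> \<le> (\<alpha>\<^sup>2 + \<alpha> + 2) / 3 * real (j - i)"
      using r(2) Suc c by (intro mult_left_mono) auto
    finally show ?thesis .
  qed
qed

section \<open>Repetitions attaining the bound\<close>

lemma exists_long_agreement:
  "\<exists>i j m. i < j \<and> mismatch_zero_two i j m \<and>
    (\<forall>r. weight r i (i + m) = (\<Sum>s<t. N (r + 1 + 2 * s)) \<and> weight r i j = N (r + 2 * t - 1))"
proof (induction t)
  case 0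
  \<comment> \<open>The prefix 0120 contains the factor 20 at positions 2 and 3.\<close>
  have "pos (Suc 0) = 2" by (simp add: pos_Suc n_0)
  moreover have n1: "n 1 = L1" using n_Suc_pos[of 0] n_0 by simp
  ultimately have n2: "n 2 = L2" and "pos 2 = 3"
    using n_pos[of "Suc 0"] pos_Suc[of "Suc 0"] by (simp_all add: numeral_2_eq_2)
  then have "n 3 = L0" using n_pos[of 2] by simp
  with n2 have "mismatch_zero_two 2 3 0" by (simp add: mismatch_zero_two_def agree_def)
  moreover have "weight r 2 3 = N (r - 1)" for r
    using n2 weight_Suc_right[of 2 2 r] by (simp add: image_length_L2)
  ultimately show ?case by (intro exI[of _ 2] exI[of _ 3] exI[of _ 0]) simp
next
  case (Suc t)
  then obtain i j m where ij: "i < j" and mm: "mismatch_zero_two i j m"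
    and w: "\<And>r. weight r i (i + m) = (\<Sum>s<t. N (r + 1 + 2 * s))"
    and u: "\<And>r. weight r i j = N (r + 2 * t - 1)" by blast
  \<comment> \<open>Two images lead back to a mismatch of \<open>L0\<close> and \<open>L2\<close>
    and add one summand.\<close>
  obtain m1 where m1: "mismatch_one (pos i) (pos j) m1"
    "\<And>r. weight r (pos i) (pos i + m1) = weight (Suc r) i (i + m) + N r"
    using mismatch_zero_two_pos[OF mm] by blast
  obtain m2 where m2: "mismatch_zero_two (pos (pos i)) (pos (pos j)) m2"
    "\<And>r. weight r (pos (pos i)) (pos (pos i) + m2) = weight (Suc r) (pos i) (pos i + m1)"
    using mismatch_one_pos[OF m1(1)] by blast
  have lt: "pos i < pos j" "pos (pos i) < pos (pos j)"
    using ij strict_mono_pos by (simp_all add: strict_mono_less)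
  have "weight r (pos (pos i)) (pos (pos i) + m2) = (\<Sum>s<Suc t. N (r + 1 + 2 * s))" for r
    unfolding m2(2) m1(2) w
    by (simp add: sum.lessThan_Suc_shift del: image_length.simps sum.lessThan_Suc)
  moreover have "weight r (pos (pos i)) (pos (pos j)) = N (r + 2 * Suc t - 1)" for r
    using lt ij by (simp add: weight_pos u del: image_length.simps)
  ultimately show ?case using m2(1) lt(2) by blast
qed

section \<open>From agreements to exponents\<close>

lemma has_period_factor:
  "has_period (map n [i..<k]) p \<longleftrightarrow> 1 \<le> p \<and> p \<le> k - i \<and> agree i (i + p) (k - i - p)"
proof -
  have "take (k - i - p) (map n [i..<k]) = drop p (map n [i..<k]) \<longleftrightarrow> agree i (i + p) (k - i - p)"
    if "p \<le> k - i"
    using that by (auto simp: list_eq_iff_nth_eq agree_def add.assoc)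
  then show ?thesis by (auto simp: has_period_def)
qed

lemma exponent_le:
  fixes \<alpha> :: real
  assumes \<alpha>: "\<alpha> ^ 3 = \<alpha> ^ 2 + 1" and "w \<in> factors n - {[]}"
  shows "exponent w \<le> (\<alpha>\<^sup>2 + \<alpha> + 5) / 3"
proof -
  obtain i k where w: "w = map n [i..<k]" and "i \<le> k" "w \<noteq> []"
    using assms(2) unfolding factors_def by blast
  then have ik: "i < k" by auto
  have "has_period w (length w)" using \<open>w \<noteq> []\<close> by (cases w) (auto simp: has_period_def)
  then have "has_period w (per w)" unfolding per_def by (rule LeastI)
  then have p: "1 \<le> per w" "per w \<le> k - i" "agree i (i + per w) (k - i - per w)"
    unfolding w by (simp_all add: has_period_factor)
  have "real (k - i - per w) \<le> (\<alpha>\<^sup>2 + \<alpha> + 2) / 3 * per w"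
    using agree_bound[OF \<alpha> _ p(3)] p(1) by simp
  \<comment> \<open>The period itself adds 1 to the ratio (\<alpha>^2 + \<alpha> + 2) / 3.\<close>
  then have "real (k - i) \<le> (\<alpha>\<^sup>2 + \<alpha> + 5) / 3 * per w"
    using p(2) by (simp add: of_nat_diff field_simps)
  then show ?thesis using p(1) by (simp add: exponent_def w divide_le_eq)
qed

lemma exponent_ge:
  fixes \<alpha> :: real
  assumes \<alpha>: "\<alpha> ^ 3 = \<alpha> ^ 2 + 1"
  shows "\<exists>w \<in> factors n - {[]}. (\<alpha>\<^sup>2 + \<alpha> + 5) / 3 - 3 / real (Suc t) \<le> exponent w"
proof -
  obtain i j m where ij: "i < j" and mm: "mismatch_zero_two i j m"
    and wu: "\<And>r. weight r i (i + m) = (\<Sum>s<Suc t. N (r + 1 + 2 * s)) \<and>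
      weight r i j = N (r + 2 * Suc t - 1)"
    using exists_long_agreement[of "Suc t"] by blast
  define P where "P = N (1 + 2 * t)"
  have m: "m = (\<Sum>s<Suc t. N (1 + 2 * s))" and "j - i = P"
    using wu[of 0] by (simp_all add: P_def del: image_length.simps)
  then have p: "j = i + P" using ij by simp
  let ?w = "map n [i..<j + m]"
  have P: "Suc t \<le> P" using N_gt[of "1 + 2 * t"] unfolding P_def by linarith
  have "agree i j m" using mm by (simp add: mismatch_zero_two_def)
  then have per: "has_period ?w P" using p P by (simp add: has_period_factor)
  \<comment> \<open>A least period below \<open>P\<close> would only raise the exponent, so this
    inequality suffices.\<close>
  then have "per ?w \<le> P" "has_period ?w (per ?w)" unfolding per_def by (auto intro: Least_le LeastI)
  then have "0 < per ?w" "per ?w \<le> P" by (simp_all add: has_period_def)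
  then have "real (P + m) / P \<le> exponent ?w"
    unfolding exponent_def using p by (simp add: frac_le)
  moreover have "(\<alpha>\<^sup>2 + \<alpha> + 2) / 3 * P - 3 \<le> m"
    using sum_N_bounds(2)[OF \<alpha>, of t] unfolding m P_def by (simp del: image_length.simps)
  then have "(\<alpha>\<^sup>2 + \<alpha> + 5) / 3 - 3 / P \<le> real (P + m) / P"
    using P by (simp add: le_divide_eq left_diff_distrib) (simp add: field_simps)
  moreover have "3 / real P \<le> 3 / real (Suc t)" using P by (intro divide_left_mono) auto
  ultimately have "(\<alpha>\<^sup>2 + \<alpha> + 5) / 3 - 3 / real (Suc t) \<le> exponent ?w" by linarith
  moreover have "?w \<in> factors n"
    unfolding factors_def using ij by (intro CollectI exI[of _ i] exI[of _ "j + m"]) simp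
  moreover have "?w \<noteq> []" using ij by simp
  ultimately show ?thesis by blast
qed

lemma critical_exponent_eq:
  fixes \<alpha> :: real
  assumes \<alpha>: "\<alpha> ^ 3 = \<alpha> ^ 2 + 1"
  shows "critical_exponent n = ereal ((\<alpha>\<^sup>2 + \<alpha> + 5) / 3)"
proof (rule antisym)
  show "critical_exponent n \<le> ereal ((\<alpha>\<^sup>2 + \<alpha> + 5) / 3)"
    unfolding critical_exponent_def
    by (intro SUP_least) (simp only: ereal_less_eq exponent_le[OF \<alpha>])
  have "(\<lambda>t. (\<alpha>\<^sup>2 + \<alpha> + 5) / 3 - 3 / real (Suc t)) \<longlonglongrightarrow> (\<alpha>\<^sup>2 + \<alpha> + 5) / 3 - 0"
    by (intro tendsto_diff tendsto_const LIMSEQ_Suc[OF lim_const_over_n])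
  then have "(\<lambda>t. ereal ((\<alpha>\<^sup>2 + \<alpha> + 5) / 3 - 3 / real (Suc t)))
    \<longlonglongrightarrow> ereal ((\<alpha>\<^sup>2 + \<alpha> + 5) / 3)" by simp
  moreover have "ereal ((\<alpha>\<^sup>2 + \<alpha> + 5) / 3 - 3 / real (Suc t)) \<le> critical_exponent n" for t
    unfolding critical_exponent_def using exponent_ge[OF \<alpha>, of t]
    by (meson SUP_upper2 ereal_less_eq(3))
  ultimately show "ereal ((\<alpha>\<^sup>2 + \<alpha> + 5) / 3) \<le> critical_exponent n"
    by (intro LIMSEQ_le_const2) blast+
qed

end

theorem theorem11:
  fixes n :: "nat \<Rightarrow> letter" and \<alpha> :: real
  assumes "fixed_point_from nu L0 n"
    and "\<alpha> ^ 3 = \<alpha> ^ 2 + 1"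
  shows "critical_exponent n = ereal ((\<alpha> ^ 2 + \<alpha> + 5) / 3)
    \<and> \<bar>(\<alpha> ^ 2 + \<alpha> + 5) / 3 - 2.8711567558605\<bar> < 1 / 10 ^ 13"
  using nu_fixed_point.critical_exponent_eq[OF nu_fixed_point.intro] root_value assms by blast

end
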